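(* Let $p_1=p_3>0$, $\rho>0$, and consider the system $$\mathcal{D}'=2\mathcal{I}(p_1\mathcal{D}-p_3\mathcal{R}),\qquad\mathcal{R}'=2\mathcal{I}(p_1\mathcal{R}-p_3\mathcal{D}),\qquad\mathcal{I}'=-2p_1(\mathcal{D}^2+\mathcal{R}^2)+4p_3\mathcal{D}\mathcal{R}$$ on $S^2_\rho$. Then $\{(2^{-\frac12}\rho\cos\theta,2^{-\frac12}\rho\cos\theta,\rho\sin\theta):\theta\in\mathbb{R}/2\pi\mathbb{Z}\}$ is the set of fixed points. If $\mathcal{D}(0)\ne\mathcal{R}(0)$, then the solution is given as follows. With $$r=\sqrt{\tfrac{2\mathcal{I}(0)^2+(\mathcal{D}(0)-\mathcal{R}(0))^2}{2}},\qquad \tau_0=-(\operatorname{sign}\mathcal{I}(0))\cosh^{-1}\sqrt{1+\tfrac{2\mathcal{I}(0)^2}{(\mathcal{D}(0)-\mathcal{R}(0))^2}},$$ $$\mathcal{D}(t)=\tfrac{\mathcal{D}(0)+\mathcal{R}(0)}{2}+\tfrac{\mathcal{D}(0)-\mathcal{R}(0)}{2}\left(\sqrt{\tfrac{(\mathcal{D}(0)-\mathcal{R}(0))^2}{(\mathcal{D}(0)-\mathcal{R}(0))^2+2\mathcal{I}(0)^2}}\;\cosh(4p_1rt+\tau_0)\right)^{-1},$$ $$\mathcal{R}(t)=\tfrac{\mathcal{D}(0)+\mathcal{R}(0)}{2}-\tfrac{\mathcal{D}(0)-\mathcal{R}(0)}{2}\left(\sqrt{\tfrac{(\mathcal{D}(0)-\mathcal{R}(0))^2}{(\mathcal{D}(0)-\mathcal{R}(0))^2+2\mathcal{I}(0)^2}}\;\cosh(4p_1rt+\tau_0)\right)^{-1},$$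 $$\mathcal{I}(t)=-r\tanh(4p_1rt+\tau_0).$$
   Context: $S^2_\rho=\{(x,y,z)\in\mathbb{R}^3: x^2+y^2+z^2=\rho^2\}$; the unknown $(\mathcal{D},\mathcal{R},\mathcal{I})$ is real valued with initial data in $S_\rho^2$, and the system preserves $S^2_\rho$. *)

theory Defs
  imports "HOL-Analysis.Analysis"
begin

definition S2 :: "real \<Rightarrow> (real \<times> real \<times> real) set" where
  "S2 \<rho> = {(x, y, z). x\<^sup>2 + y\<^sup>2 + z\<^sup>2 = \<rho>\<^sup>2}"

fun vfield :: "real \<Rightarrow> real \<Rightarrow> real \<times> real \<times> real \<Rightarrow> real \<times> real \<times> real" where
  "vfield p1 p3 (D, R, I) =
     (2 * I * (p1 * D - p3 * R),
      2 * I * (p1 * R - p3 * D),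
      - 2 * p1 * (D\<^sup>2 + R\<^sup>2) + 4 * p3 * D * R)"

text \<open>Derivatives are taken within the time interval \<open>J\<close>, hence one-sided at any
  endpoint that belongs to \<open>J\<close>.\<close>

definition solves_on :: "real \<Rightarrow> real \<Rightarrow> real set \<Rightarrow> (real \<Rightarrow> real \<times> real \<times> real) \<Rightarrow> bool" where
  "solves_on p1 p3 J u \<longleftrightarrow>
     (\<forall>t\<in>J. (u has_vector_derivative vfield p1 p3 (u t)) (at t within J))"

definition fixed_points :: "real \<Rightarrow> real \<Rightarrow> real \<Rightarrow> (real \<times> real \<times> real) set" where
  "fixed_points p1 p3 \<rho> = {v \<in> S2 \<rho>. vfield p1 p3 v = 0}"

end

theory Submission
  imports Defs
begin

text \<open>For \<open>p1 = p3 = p\<close> the sum \<open>D + R\<close> is conserved and \<open>w = D - R\<close> obeys \<open>w' = 4 p I w\<close>,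
  \<open>I' = - 2 p w\<^sup>2\<close>, with conserved quantity \<open>w\<^sup>2 + 2 I\<^sup>2 = 2 r\<^sup>2\<close>. Hence \<open>I' = - 4 p (r\<^sup>2 - I\<^sup>2)\<close>, which
  integrates to a hyperbolic tangent, and \<open>w\<close> is then a multiple of \<open>1 / cosh\<close>. For uniqueness, put
  \<open>s = 4 p r t + \<tau>\<close> and \<open>P = I cosh s + r sinh s\<close>: along any solution \<open>P' = 4 p I P\<close> and
  \<open>(w cosh s)' = 4 p w P\<close>, so \<open>P\<close> vanishes identically if it vanishes at time \<open>0\<close>, and then
  \<open>w cosh s\<close> is constant.\<close>

section \<open>Monotonicity and linear equations on an interval\<close>

lemma mem_interval_segment:
  fixes J :: "real set"
  assumes "is_interval J" "a \<in> J" "b \<in> J"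
  shows "{a..b} \<subseteq> J"
  using assms unfolding is_interval_1 by (meson atLeastAtMost_iff subsetI)

text \<open>The mean value theorem on \<open>{a..b}\<close>: the derivative within \<open>J\<close>
  restricts to this segment, so one-sided derivatives at endpoints belonging to \<open>J\<close> are
  covered.\<close>

lemma nonneg_derivative_within_imp_le:
  fixes f f' :: "real \<Rightarrow> real"
  assumes "is_interval J" "a \<in> J" "b \<in> J" "a \<le> b"
    and deriv: "\<And>t. t \<in> J \<Longrightarrow> (f has_real_derivative f' t) (at t within J)"
    and "\<And>t. t \<in> J \<Longrightarrow> 0 \<le> f' t"
  shows "f a \<le> f b"
proof -
  have sub: "{a..b} \<subseteq> J"
    using assms(1-3) by (rule mem_interval_segment)
  have "\<exists>x\<in>{a..b}. f b - f a = f' x * (b - a)"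
  proof (rule mvt_very_simple[OF \<open>a \<le> b\<close>])
    fix x assume "a \<le> x" "x \<le> b"
    then have "x \<in> J" using sub by auto
    then show "(f has_derivative (*) (f' x)) (at x within {a..b})"
      using has_field_derivative_subset[OF deriv sub] unfolding has_field_derivative_def by blast
  qed
  then obtain x where x: "x \<in> {a..b}" "f b - f a = f' x * (b - a)" by blast
  have "0 \<le> f' x * (b - a)"
    using x(1) sub assms(4,6) by (intro mult_nonneg_nonneg) auto
  with x(2) show ?thesis by linarith
qed

text \<open>A Gronwall argument. Since \<open>\<bar>a t\<bar> \<le> K\<close>, the function y^2
  exp(-2Kt) is nonincreasing, which carries the zero forward from \<open>t0\<close>, and y^2
  exp(2Kt) is nondecreasing, which carries it backward.\<close>

lemma linear_ode_zero:
  fixes y a :: "real \<Rightarrow> real"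
  assumes J: "is_interval J" "t0 \<in> J" "t \<in> J"
    and deriv: "\<And>t. t \<in> J \<Longrightarrow> (y has_real_derivative a t * y t) (at t within J)"
    and bound: "\<And>t. t \<in> J \<Longrightarrow> \<bar>a t\<bar> \<le> K"
    and "y t0 = 0"
  shows "y t = 0"
proof (cases "t0 \<le> t")
  case True
  have "- ((y t0)\<^sup>2 * exp (- 2 * K * t0)) \<le> - ((y t)\<^sup>2 * exp (- 2 * K * t))"
  proof (rule nonneg_derivative_within_imp_le[OF J True])
    fix s assume s: "s \<in> J"
    show "((\<lambda>t. - ((y t)\<^sup>2 * exp (- 2 * K * t))) has_real_derivative
            2 * (K - a s) * (y s)\<^sup>2 * exp (- 2 * K * s)) (at s within J)"
      by (auto intro!: derivative_eq_intros deriv[OF s] simp: algebra_simps power2_eq_square)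
    show "0 \<le> 2 * (K - a s) * (y s)\<^sup>2 * exp (- 2 * K * s)"
      using bound[OF s] by simp
  qed
  then show ?thesis using \<open>y t0 = 0\<close> by (simp add: mult_le_0_iff)
next
  case False
  then have "t \<le> t0" by simp
  have "(y t)\<^sup>2 * exp (2 * K * t) \<le> (y t0)\<^sup>2 * exp (2 * K * t0)"
  proof (rule nonneg_derivative_within_imp_le[OF J(1,3,2) \<open>t \<le> t0\<close>])
    fix s assume s: "s \<in> J"
    show "((\<lambda>t. (y t)\<^sup>2 * exp (2 * K * t)) has_real_derivative
            2 * (K + a s) * (y s)\<^sup>2 * exp (2 * K * s)) (at s within J)"
      by (auto intro!: derivative_eq_intros deriv[OF s] simp: algebra_simps power2_eq_square)
    show "0 \<le> 2 * (K + a s) * (y s)\<^sup>2 * exp (2 * K * s)"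
      using bound[OF s] by simp
  qed
  then show ?thesis using \<open>y t0 = 0\<close> by (simp add: mult_le_0_iff)
qed

section \<open>The system in coordinates and its explicit solutions\<close>

lemma has_vector_derivative_Pair_iff:
  "((\<lambda>t. (f t, g t)) has_vector_derivative (f', g')) (at t within J) \<longleftrightarrow>
     (f has_vector_derivative f') (at t within J) \<and> (g has_vector_derivative g') (at t within J)"
proof
  assume *: "((\<lambda>t. (f t, g t)) has_vector_derivative (f', g')) (at t within J)"
  show "(f has_vector_derivative f') (at t within J) \<and> (g has_vector_derivative g') (at t within J)"
    using bounded_linear.has_vector_derivative[OF bounded_linear_fst *]
      bounded_linear.has_vector_derivative[OF bounded_linear_snd *] by simp
next
  assume "(f has_vector_derivative f') (at t within J) \<and> (g has_vector_derivative g') (at t within J)"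
  then show "((\<lambda>t. (f t, g t)) has_vector_derivative (f', g')) (at t within J)"
    using has_vector_derivative_Pair by blast
qed

text \<open>For equal parameters the quadratic form in the third component is a perfect square, so
  the right-hand side depends on \<open>D\<close> and \<open>R\<close> only through their
  difference.\<close>

lemma solves_on_iff_components:
  "solves_on p p J (\<lambda>t. (D t, R t, I t)) \<longleftrightarrow>
     (\<forall>t\<in>J. (D has_real_derivative 2 * p * I t * (D t - R t)) (at t within J)
          \<and> (R has_real_derivative - (2 * p * I t * (D t - R t))) (at t within J)
          \<and> (I has_real_derivative - (2 * p * (D t - R t)\<^sup>2)) (at t within J))"
proof -
  have "vfield p p (d, e, i) =
      (2 * p * i * (d - e), - (2 * p * i * (d - e)), - (2 * p * (d - e)\<^sup>2))" for d e i
    by (simp add: algebra_simps power2_eq_square)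
  then show ?thesis
    by (simp add: solves_on_def has_vector_derivative_Pair_iff
        has_real_derivative_iff_has_vector_derivative del: vfield.simps)
qed

text \<open>The first two equations hold for every \<open>\<kappa>\<close>, because (1 / cosh)' = -
  tanh / cosh. The third compares r^2 / cosh^2 with \<kappa>^2 / (2 cosh^2), hence the condition on
  \<open>\<kappa>\<close>. The sign of \<open>\<kappa>\<close> stays free and is the sign of D -
  R.\<close>

lemma sech_tanh_solves:
  fixes p r \<kappa> m \<tau> :: real
  assumes \<kappa>: "\<kappa>\<^sup>2 = 2 * r\<^sup>2"
  shows "solves_on p p UNIV (\<lambda>t. (m + \<kappa> / (2 * cosh (4 * p * r * t + \<tau>)),
            m - \<kappa> / (2 * cosh (4 * p * r * t + \<tau>)), - r * tanh (4 * p * r * t + \<tau>)))"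
  unfolding solves_on_iff_components
proof (intro ballI conjI)
  fix t :: real
  let ?s = "4 * p * r * t + \<tau>"
  have pos: "cosh ?s \<noteq> 0" by (simp add: cosh_real_pos less_imp_neq[symmetric])
  show "((\<lambda>t. m + \<kappa> / (2 * cosh (4 * p * r * t + \<tau>))) has_real_derivative
      2 * p * (- r * tanh ?s) * (m + \<kappa> / (2 * cosh ?s) - (m - \<kappa> / (2 * cosh ?s)))) (at t)"
    using pos by (auto intro!: derivative_eq_intros simp: tanh_def field_simps power2_eq_square)
  show "((\<lambda>t. m - \<kappa> / (2 * cosh (4 * p * r * t + \<tau>))) has_real_derivative
      - (2 * p * (- r * tanh ?s) * (m + \<kappa> / (2 * cosh ?s) - (m - \<kappa> / (2 * cosh ?s))))) (at t)"
    using pos by (auto intro!: derivative_eq_intros simp: tanh_def field_simps power2_eq_square)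
  have "1 - (tanh ?s)\<^sup>2 = 1 / (cosh ?s)\<^sup>2"
    using pos by (simp add: tanh_def power_divide sinh_square_eq field_simps)
  moreover have "(m + \<kappa> / (2 * cosh ?s) - (m - \<kappa> / (2 * cosh ?s)))\<^sup>2 = 2 * r\<^sup>2 * (1 / (cosh ?s)\<^sup>2)"
    using pos by (simp add: \<kappa>[symmetric] power_divide)
  moreover have "((\<lambda>t. - r * tanh (4 * p * r * t + \<tau>)) has_real_derivative
      - r * ((1 - (tanh ?s)\<^sup>2) * (4 * p * r))) (at t)"
    using pos by (auto intro!: derivative_eq_intros)
  moreover have "- r * (1 / (cosh ?s)\<^sup>2 * (4 * p * r)) = - (2 * p * (2 * r\<^sup>2 * (1 / (cosh ?s)\<^sup>2)))"
    by (simp add: power2_eq_square)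
  ultimately show "((\<lambda>t. - r * tanh (4 * p * r * t + \<tau>)) has_real_derivative
      - (2 * p * (m + \<kappa> / (2 * cosh ?s) - (m - \<kappa> / (2 * cosh ?s)))\<^sup>2)) (at t)"
    by metis
qed

lemma sech_tanh_unique:
  fixes p r \<kappa> m \<tau> :: real and D R I :: "real \<Rightarrow> real"
  assumes J: "is_interval J" "0 \<in> J" "t \<in> J"
    and sol: "solves_on p p J (\<lambda>t. (D t, R t, I t))"
    and \<kappa>: "\<kappa>\<^sup>2 = 2 * r\<^sup>2" and "0 \<le> r"
    and init: "D 0 = m + \<kappa> / (2 * cosh \<tau>)" "R 0 = m - \<kappa> / (2 * cosh \<tau>)" "I 0 = - r * tanh \<tau>"
  shows "D t = m + \<kappa> / (2 * cosh (4 * p * r * t + \<tau>))"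
    and "R t = m - \<kappa> / (2 * cosh (4 * p * r * t + \<tau>))"
    and "I t = - r * tanh (4 * p * r * t + \<tau>)"
proof -
  define w where "w = (\<lambda>t. D t - R t)"
  define P where "P = (\<lambda>t. I t * cosh (4 * p * r * t + \<tau>) + r * sinh (4 * p * r * t + \<tau>))"
  have dD: "(D has_real_derivative 2 * p * I s * w s) (at s within J)"
    and dR: "(R has_real_derivative - (2 * p * I s * w s)) (at s within J)"
    and dI: "(I has_real_derivative - (2 * p * (w s)\<^sup>2)) (at s within J)" if "s \<in> J" for s
    using sol that by (auto simp: solves_on_iff_components w_def)
  have dw: "(w has_real_derivative 4 * p * I s * w s) (at s within J)" if "s \<in> J" for s
    unfolding w_def by (rule derivative_eq_intros dD[OF that] dR[OF that] refl)+ (simp add: w_def)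
  have cosh_nz: "cosh x \<noteq> 0" for x :: real by (simp add: cosh_real_pos less_imp_neq[symmetric])
  have const: "f s = f 0" if "s \<in> J" "\<And>s. s \<in> J \<Longrightarrow> (f has_real_derivative 0) (at s within J)"
    for f :: "real \<Rightarrow> real" and s
    using has_field_derivative_zero_constant[OF is_interval_convex[OF J(1)] that(2)] that(1) J(2)
    by metis
  have energy: "(w s)\<^sup>2 + 2 * (I s)\<^sup>2 = 2 * r\<^sup>2" if "s \<in> J" for s
  proof -
    have "(w s)\<^sup>2 + 2 * (I s)\<^sup>2 = (w 0)\<^sup>2 + 2 * (I 0)\<^sup>2"
      by (rule const[OF that])
        (rule derivative_eq_intros dw dI refl | assumption | simp add: power2_eq_square)+
    also have "\<dots> = 2 * r\<^sup>2 / (cosh \<tau>)\<^sup>2 + 2 * r\<^sup>2 * (sinh \<tau>)\<^sup>2 / (cosh \<tau>)\<^sup>2"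
      by (simp add: w_def init power_divide power_mult_distrib \<kappa> tanh_def)
    also have "\<dots> = 2 * r\<^sup>2"
      using cosh_nz[of \<tau>] by (simp add: sinh_square_eq field_simps)
    finally show ?thesis .
  qed
  have P_zero: "P s = 0" if "s \<in> J" for s
  proof (rule linear_ode_zero[OF J(1,2) that])
    show "(P has_real_derivative (4 * p * I s) * P s) (at s within J)" if s: "s \<in> J" for s
    proof -
      \<comment> \<open>The left side is the coefficient of cosh in P'. Energy turns it into 4 p
        I^2, so that 4 p I factors out of P'.\<close>
      have "- (2 * p * (w s)\<^sup>2) + r * (4 * p * r) = (4 * p * I s) * I s"
        using energy[OF s] by algebra
      then have "- (2 * p * (w s)\<^sup>2) * cosh (4 * p * r * s + \<tau>)
          + I s * (sinh (4 * p * r * s + \<tau>) * (4 * p * r)) + r * (cosh (4 * p * r * s + \<tau>) * (4 * p * r))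
          = (4 * p * I s) * P s"
        unfolding P_def by algebra
      then show ?thesis unfolding P_def
        by (auto intro!: derivative_eq_intros dI[OF s] simp: algebra_simps)
    qed
    \<comment> \<open>Energy conservation confines I to [-r, r], which gives one bound for the
      coefficient on all of \<open>J\<close>, even if \<open>J\<close> is unbounded.\<close>
    show "\<bar>4 * p * I s\<bar> \<le> 4 * \<bar>p\<bar> * r" if s: "s \<in> J" for s
    proof -
      have "(I s)\<^sup>2 \<le> r\<^sup>2" using energy[OF s] zero_le_power2[of "w s"] by linarith
      then have "\<bar>I s\<bar> \<le> r" using \<open>0 \<le> r\<close> abs_le_square_iff[of "I s" r] by simp
      then show ?thesis by (simp add: abs_mult mult_left_mono)
    qed
    show "P 0 = 0" using cosh_nz[of \<tau>] by (simp add: P_def init tanh_def)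
  qed
  show "I t = - r * tanh (4 * p * r * t + \<tau>)"
    using P_zero[OF J(3)] cosh_nz[of "4 * p * r * t + \<tau>"] by (simp add: P_def tanh_def field_simps)
  have "w t * cosh (4 * p * r * t + \<tau>) = w 0 * cosh (4 * p * r * 0 + \<tau>)"
  proof (rule const[OF J(3)])
    fix s assume s: "s \<in> J"
    have "((\<lambda>t. w t * cosh (4 * p * r * t + \<tau>)) has_real_derivative 4 * p * w s * P s) (at s within J)"
      by (rule derivative_eq_intros dw[OF s] refl | simp)+ (simp add: P_def algebra_simps)
    then show "((\<lambda>t. w t * cosh (4 * p * r * t + \<tau>)) has_real_derivative 0) (at s within J)"
      using P_zero[OF s] by simp
  qed
  then have w: "D t - R t = \<kappa> / cosh (4 * p * r * t + \<tau>)"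
    using cosh_nz[of \<tau>] cosh_nz[of "4 * p * r * t + \<tau>"] by (simp add: w_def init field_simps)
  have "D t + R t = D 0 + R 0"
    by (rule const[OF J(3)]) (rule derivative_eq_intros dD dR refl | assumption | simp)+
  then have m: "D t + R t = 2 * m" by (simp add: init)
  show "D t = m + \<kappa> / (2 * cosh (4 * p * r * t + \<tau>))" "R t = m - \<kappa> / (2 * cosh (4 * p * r * t + \<tau>))"
    using w m by simp_all
qed

text \<open>The cross terms in m and \<kappa> cancel, and what remains is r^2 times (1 + sinh^2) /
  cosh^2 = 1. The squared norm is therefore independent of \<open>s\<close>, so the explicit
  solution stays on its sphere.\<close>

lemma sech_tanh_sphere:
  fixes r \<kappa> m s :: real
  assumes "\<kappa>\<^sup>2 = 2 * r\<^sup>2"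
  shows "(m + \<kappa> / (2 * cosh s))\<^sup>2 + (m - \<kappa> / (2 * cosh s))\<^sup>2 + (- r * tanh s)\<^sup>2 = 2 * m\<^sup>2 + r\<^sup>2"
proof -
  have "cosh s \<noteq> 0" by (simp add: cosh_real_pos less_imp_neq[symmetric])
  have "(m + \<kappa> / (2 * cosh s))\<^sup>2 + (m - \<kappa> / (2 * cosh s))\<^sup>2 + (- r * tanh s)\<^sup>2
      = 2 * m\<^sup>2 + (\<kappa>\<^sup>2 / 2 + r\<^sup>2 * (sinh s)\<^sup>2) / (cosh s)\<^sup>2"
    using \<open>cosh s \<noteq> 0\<close> by (simp add: tanh_def field_simps power2_eq_square)
  also have "\<dots> = 2 * m\<^sup>2 + r\<^sup>2"
    using \<open>cosh s \<noteq> 0\<close> assms by (simp add: sinh_square_eq field_simps)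
  finally show ?thesis .
qed

text \<open>Here w stands for D(0) - R(0) and i for I(0). As \<open>arcosh\<close> is nonnegative,
  cosh \<tau> fixes only the size of \<tau>; the factor \<open>- sgn i\<close> selects the sign for
  which - r tanh \<tau> has the sign of i.\<close>

lemma initial_phase:
  fixes w i :: real
  assumes "w \<noteq> 0"
  defines "\<tau> \<equiv> - sgn i * arcosh (sqrt (1 + 2 * i\<^sup>2 / w\<^sup>2))"
  shows "cosh \<tau> = inverse (sqrt (w\<^sup>2 / (w\<^sup>2 + 2 * i\<^sup>2)))"
    and "- sqrt ((2 * i\<^sup>2 + w\<^sup>2) / 2) * tanh \<tau> = i"
proof -
  define c where "c = sqrt (1 + 2 * i\<^sup>2 / w\<^sup>2)"
  have c1: "1 \<le> c" by (simp add: c_def)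
  have c2: "c\<^sup>2 = 1 + 2 * i\<^sup>2 / w\<^sup>2" by (simp add: c_def)
  have \<tau>: "\<tau> = - sgn i * arcosh c"
    by (simp add: \<tau>_def c_def)
  \<comment> \<open>For i = 0 the factor \<open>sgn i\<close> makes \<tau> = 0, so cosh \<tau> = c
    requires c = 1.\<close>
  have "c = 1" if "i = 0"
    using that by (simp add: c_def)
  then have cosh: "cosh \<tau> = c"
    using c1 by (cases "i = 0") (auto simp: \<tau> sgn_if)
  have "c = inverse (sqrt (w\<^sup>2 / (w\<^sup>2 + 2 * i\<^sup>2)))"
    using assms by (simp add: c_def real_sqrt_inverse[symmetric] add_divide_distrib)
  with cosh show "cosh \<tau> = inverse (sqrt (w\<^sup>2 / (w\<^sup>2 + 2 * i\<^sup>2)))" by simp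
  \<comment> \<open>This identifies sinh (arcosh c) as the nonnegative root of c^2 - 1 = 2 i^2 /
    w^2.\<close>
  have "0 \<le> sinh (arcosh c)" using c1 by simp
  moreover have "(sinh (arcosh c))\<^sup>2 = (sqrt 2 * \<bar>i\<bar> / \<bar>w\<bar>)\<^sup>2"
    using c1 c2 by (simp add: sinh_square_eq power_divide power_mult_distrib)
  ultimately have "sinh (arcosh c) = sqrt 2 * \<bar>i\<bar> / \<bar>w\<bar>"
    by (simp add: power2_eq_iff_nonneg)
  then have sinh: "sinh \<tau> = - (sqrt 2 * i / \<bar>w\<bar>)"
    by (cases "i = 0") (auto simp: \<tau> sgn_if)
  have "(2 * i\<^sup>2 + w\<^sup>2) / 2 = (c * \<bar>w\<bar> / sqrt 2)\<^sup>2"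
    using assms(1) by (simp add: power_divide power_mult_distrib c2 field_simps)
  then have "sqrt ((2 * i\<^sup>2 + w\<^sup>2) / 2) = c * \<bar>w\<bar> / sqrt 2"
    using c1 by (simp add: real_sqrt_abs abs_mult)
  then show "- sqrt ((2 * i\<^sup>2 + w\<^sup>2) / 2) * tanh \<tau> = i"
    using c1 assms(1) by (simp add: tanh_def cosh sinh)
qed

section \<open>The fixed points\<close>

lemma two_powr_minus_half: "2 powr - (1 / 2) = (1 / sqrt 2 :: real)"
  by (simp add: powr_minus powr_half_sqrt field_simps)

text \<open>The third component of the field is -2 p (x - y)^2, so a zero has x = y, and then the
  other two components vanish as well. The plane x = y cuts the sphere in the great circle 2 x^2 +
  z^2 = \<rho>^2.\<close>

lemma fixed_points_equal:
  fixes p \<rho> :: real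
  assumes "p \<noteq> 0" "\<rho> > 0"
  shows "fixed_points p p \<rho> =
    {(2 powr (- 1 / 2) * \<rho> * cos \<theta>, 2 powr (- 1 / 2) * \<rho> * cos \<theta>, \<rho> * sin \<theta>) | \<theta> :: real. True}"
    (is "_ = ?C")
proof (intro equalityI subsetI)
  fix v assume v: "v \<in> fixed_points p p \<rho>"
  obtain x y z where xyz: "v = (x, y, z)" by (cases v)
  have "p * (x - y)\<^sup>2 = 0" and S: "x\<^sup>2 + y\<^sup>2 + z\<^sup>2 = \<rho>\<^sup>2"
    using v by (auto simp: xyz fixed_points_def S2_def zero_prod_def power2_eq_square algebra_simps)
  then have "y = x" using \<open>p \<noteq> 0\<close> by simp
  \<comment> \<open>Rescaling puts the point on the unit circle, where it has an angle.\<close>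
  with S have "(sqrt 2 * x / \<rho>)\<^sup>2 + (z / \<rho>)\<^sup>2 = 1"
    using \<open>\<rho> > 0\<close> by (simp add: power_divide power_mult_distrib field_simps)
  then obtain \<theta> where "sqrt 2 * x / \<rho> = cos \<theta>" "z / \<rho> = sin \<theta>"
    using sincos_total_2pi by metis
  then have "x = 2 powr (- 1 / 2) * \<rho> * cos \<theta>" "z = \<rho> * sin \<theta>"
    using \<open>\<rho> > 0\<close> by (simp_all add: two_powr_minus_half field_simps)
  with \<open>y = x\<close> show "v \<in> ?C" by (auto simp: xyz)
next
  fix v assume "v \<in> ?C"
  then obtain \<theta> where v: "v = (2 powr (- 1 / 2) * \<rho> * cos \<theta>, 2 powr (- 1 / 2) * \<rho> * cos \<theta>, \<rho> * sin \<theta>)"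
    by blast
  have "\<rho>\<^sup>2 * (cos \<theta>)\<^sup>2 + \<rho>\<^sup>2 * (sin \<theta>)\<^sup>2 = \<rho>\<^sup>2"
    by (metis distrib_left mult.right_neutral sin_cos_squared_add2 power2_eq_square)
  then show "v \<in> fixed_points p p \<rho>"
    by (simp add: v fixed_points_def S2_def two_powr_minus_half zero_prod_def power_divide
        power_mult_distrib) (simp add: power2_eq_square)
qed

theorem proposition2p19:
  fixes p1 p3 \<rho> :: real
  assumes "p1 = p3" and "p1 > 0" and "\<rho> > 0"
  shows "fixed_points p1 p3 \<rho> =
           {(2 powr (- 1 / 2) * \<rho> * cos \<theta>, 2 powr (- 1 / 2) * \<rho> * cos \<theta>, \<rho> * sin \<theta>) | \<theta> :: real. True}
    \<and> (\<forall>D0 R0 I0 :: real. (D0, R0, I0) \<in> S2 \<rho> \<longrightarrow> D0 \<noteq> R0 \<longrightarrow>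
        (let r = sqrt ((2 * I0\<^sup>2 + (D0 - R0)\<^sup>2) / 2);
             \<tau>0 = - sgn I0 * arcosh (sqrt (1 + 2 * I0\<^sup>2 / (D0 - R0)\<^sup>2));
             D = (\<lambda>t. (D0 + R0) / 2 + (D0 - R0) / 2 *
                   inverse (sqrt ((D0 - R0)\<^sup>2 / ((D0 - R0)\<^sup>2 + 2 * I0\<^sup>2)) * cosh (4 * p1 * r * t + \<tau>0)));
             R = (\<lambda>t. (D0 + R0) / 2 - (D0 - R0) / 2 *
                   inverse (sqrt ((D0 - R0)\<^sup>2 / ((D0 - R0)\<^sup>2 + 2 * I0\<^sup>2)) * cosh (4 * p1 * r * t + \<tau>0)));
             I = (\<lambda>t. - r * tanh (4 * p1 * r * t + \<tau>0));
             u = (\<lambda>t. (D t, R t, I t))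
         in solves_on p1 p3 UNIV u \<and> u 0 = (D0, R0, I0) \<and> (\<forall>t. u t \<in> S2 \<rho>)
            \<and> (\<forall>J v. is_interval J \<longrightarrow> 0 \<in> J \<longrightarrow> solves_on p1 p3 J v \<longrightarrow> v 0 = (D0, R0, I0)
                 \<longrightarrow> (\<forall>t\<in>J. v t = u t))))"
proof (intro conjI allI impI)
  show "fixed_points p1 p3 \<rho> =
      {(2 powr (- 1 / 2) * \<rho> * cos \<theta>, 2 powr (- 1 / 2) * \<rho> * cos \<theta>, \<rho> * sin \<theta>) | \<theta> :: real. True}"
    using fixed_points_equal[of p3 \<rho>] assms by simp
next
  fix D0 R0 I0 :: real
  assume S: "(D0, R0, I0) \<in> S2 \<rho>" and "D0 \<noteq> R0"
  define r where "r = sqrt ((2 * I0\<^sup>2 + (D0 - R0)\<^sup>2) / 2)"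
  define \<tau> where "\<tau> = - sgn I0 * arcosh (sqrt (1 + 2 * I0\<^sup>2 / (D0 - R0)\<^sup>2))"
  define q where "q = sqrt ((D0 - R0)\<^sup>2 / ((D0 - R0)\<^sup>2 + 2 * I0\<^sup>2))"
  define m where "m = (D0 + R0) / 2"
  \<comment> \<open>As q will turn out to be 1 / cosh \<tau>, this choice gives \<kappa> / cosh
    \<tau> = D0 - R0, the required initial difference; \<open>m\<close> is the conserved mean of D
    and R.\<close>
  define \<kappa> where "\<kappa> = (D0 - R0) / q"
  define u where "u = (\<lambda>t. (m + \<kappa> / (2 * cosh (4 * p1 * r * t + \<tau>)),
      m - \<kappa> / (2 * cosh (4 * p1 * r * t + \<tau>)), - r * tanh (4 * p1 * r * t + \<tau>)))"
  have pos: "0 < (D0 - R0)\<^sup>2" using \<open>D0 \<noteq> R0\<close> by simp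
  have r2: "r\<^sup>2 = (2 * I0\<^sup>2 + (D0 - R0)\<^sup>2) / 2" and "0 \<le> r" by (simp_all add: r_def)
  have \<kappa>: "\<kappa>\<^sup>2 = 2 * r\<^sup>2"
    using pos by (simp add: \<kappa>_def q_def r2 power_divide)
  have "q \<noteq> 0" using pos by (simp add: q_def add_pos_nonneg less_imp_neq[symmetric])
  have phase: "cosh \<tau> = inverse q" "- r * tanh \<tau> = I0"
    using initial_phase[of "D0 - R0" I0] \<open>D0 \<noteq> R0\<close> by (simp_all add: \<tau>_def q_def r_def)
  have init: "m + \<kappa> / (2 * cosh \<tau>) = D0" "m - \<kappa> / (2 * cosh \<tau>) = R0"
    using \<open>q \<noteq> 0\<close> by (simp_all add: phase(1) m_def \<kappa>_def field_simps)
  have solves: "solves_on p1 p3 UNIV u"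
    using sech_tanh_solves[OF \<kappa>] \<open>p1 = p3\<close> by (simp add: u_def)
  have start: "u 0 = (D0, R0, I0)"
    using init phase(2) by (simp add: u_def)
  have sphere: "u t \<in> S2 \<rho>" for t
  proof -
    \<comment> \<open>The parallelogram identity for D0 + R0 and D0 - R0.\<close>
    have "2 * m\<^sup>2 + r\<^sup>2 = D0\<^sup>2 + R0\<^sup>2 + I0\<^sup>2"
      by (simp add: m_def r2 power2_sum power2_diff power_divide field_simps)
    also have "\<dots> = \<rho>\<^sup>2" using S by (simp add: S2_def)
    finally show ?thesis using sech_tanh_sphere[OF \<kappa>] by (simp add: u_def S2_def)
  qed
  have unique: "v t = u t"
    if "is_interval J" "0 \<in> J" "solves_on p1 p3 J v" "v 0 = (D0, R0, I0)" "t \<in> J" for J v t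
  proof -
    \<comment> \<open>Splits \<open>v\<close> into the three scalar functions that
      \<open>sech_tanh_unique\<close> expects.\<close>
    have "solves_on p1 p1 J (\<lambda>t. (fst (v t), fst (snd (v t)), snd (snd (v t))))"
      using that(3) \<open>p1 = p3\<close> by simp
    from sech_tanh_unique[OF that(1,2,5) this \<kappa> \<open>0 \<le> r\<close>, of m \<tau>]
    show ?thesis using init phase(2) that(4) by (simp add: u_def prod_eq_iff)
  qed
  \<comment> \<open>Moves q from \<kappa> back next to cosh, which recovers the displayed form of
    the solution.\<close>
  have "\<kappa> / (2 * c) = (D0 - R0) / 2 * inverse (q * c)" for c
    by (simp add: \<kappa>_def inverse_eq_divide)
  then have u_eq: "u = (\<lambda>t. ((D0 + R0) / 2 + (D0 - R0) / 2 * inverse (q * cosh (4 * p1 * r * t + \<tau>)),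
      (D0 + R0) / 2 - (D0 - R0) / 2 * inverse (q * cosh (4 * p1 * r * t + \<tau>)),
      - r * tanh (4 * p1 * r * t + \<tau>)))"
    by (simp add: u_def m_def)
  show "let r = sqrt ((2 * I0\<^sup>2 + (D0 - R0)\<^sup>2) / 2);
             \<tau>0 = - sgn I0 * arcosh (sqrt (1 + 2 * I0\<^sup>2 / (D0 - R0)\<^sup>2));
             D = (\<lambda>t. (D0 + R0) / 2 + (D0 - R0) / 2 *
                   inverse (sqrt ((D0 - R0)\<^sup>2 / ((D0 - R0)\<^sup>2 + 2 * I0\<^sup>2)) * cosh (4 * p1 * r * t + \<tau>0)));
             R = (\<lambda>t. (D0 + R0) / 2 - (D0 - R0) / 2 *
                   inverse (sqrt ((D0 - R0)\<^sup>2 / ((D0 - R0)\<^sup>2 + 2 * I0\<^sup>2)) * cosh (4 * p1 * r * t + \<tau>0)));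
             I = (\<lambda>t. - r * tanh (4 * p1 * r * t + \<tau>0));
             u = (\<lambda>t. (D t, R t, I t))
         in solves_on p1 p3 UNIV u \<and> u 0 = (D0, R0, I0) \<and> (\<forall>t. u t \<in> S2 \<rho>)
            \<and> (\<forall>J v. is_interval J \<longrightarrow> 0 \<in> J \<longrightarrow> solves_on p1 p3 J v \<longrightarrow> v 0 = (D0, R0, I0)
                 \<longrightarrow> (\<forall>t\<in>J. v t = u t))"
    unfolding Let_def r_def[symmetric] \<tau>_def[symmetric] q_def[symmetric]
    using solves start sphere unique unfolding u_eq by blast
qed

end
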